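(* Let $1\le k\le n-1$ and $\nu_1,\dots,\nu_k\in\mathbb{N}_0$. If $|\{\nu_1\bmod n,\dots,\nu_k\bmod n\}|\le 2$, then there exists a $k$-dimensional $\sigma$-cyclic convolutional code in $\mathbb{F}[z]^n$ with Forney indices $\nu_1,\dots,\nu_k$.
   Context: Let $\mathbb{F}$ be a finite field with $q$ elements and $n\ge2$ a divisor of $q-1$. Let $A=\mathbb{F}\times\cdots\times\mathbb{F}$ ($n$ copies), elements $[a_1,\dots,a_n]$, and $\sigma([a_1,\dots,a_n])=[a_n,a_1,\dots,a_{n-1}]$. $A[z;\sigma]$ is the skew polynomial ring of polynomials $\sum_\nu z^\nu a_\nu$ ($a_\nu\in A$, right coefficients) with multiplication determined by $az=z\sigma(a)$ for $a\in A$. Fix an $\mathbb{F}$-algebra isomorphism $\phi:\mathbb{F}[x]/\langle x^n-1\rangle\to A$ and let $\mathfrak{p}:\mathbb{F}[z]^n\to A[z;\sigma]$, $\sum_\nu z^\nu v_\nu\mapsto\sum_\nu z^\nu\phi(\sum_{i=0}^{n-1}v_{\nu,i}x^i)$. A convolutional code of length $n$ and dimension $k$ is a submodule $\{uG\mid u\in\mathbb{F}[z]^k\}\subseteq\mathbb{F}[z]^n$ with $G\in\mathbb{F}[z]^{k\times n}$ basic (rank $k$ at every point of an algebraic closure of $\mathbb{F}$); $G$ is a minimal encoder if the sum of its row degrees equals the maximal degree of its $k\times k$ minors, and the row degrees of a minimal encoder (unique up to order) are the Forney indices of the code. A $\sigma$-cyclic convolutional code is a convolutional code $\mathcal{C}$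 such that $\mathfrak{p}(\mathcal{C})$ is a left ideal of $A[z;\sigma]$. *)

theory Defs
  imports "HOL-Algebra.Algebraic_Closure_Type"
          "HOL-Computational_Algebra.Polynomial"
          "HOL-Combinatorics.Permutations"
begin

text \<open>Indices are 0-based. A vector in F[z]^n is a function nat => 'a poly
  (only the components i < n matter; we require the others to be 0).
  A k x n polynomial matrix is a function nat => nat => 'a poly
  (row index i < k, column index j < n).\<close>

definition code_of :: "nat \<Rightarrow> nat \<Rightarrow> (nat \<Rightarrow> nat \<Rightarrow> 'a::field poly) \<Rightarrow> (nat \<Rightarrow> 'a poly) set" where
  "code_of n k G = {(\<lambda>j. if j < n then (\<Sum>i<k. u i * G i j) else 0) | u. True}"

definition basic_enc :: "nat \<Rightarrow> nat \<Rightarrow> (nat \<Rightarrow> nat \<Rightarrow> 'a::field poly) \<Rightarrow> bool" where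
  "basic_enc n k G \<longleftrightarrow>
     (\<forall>(l::'a alg_closure) (c::nat \<Rightarrow> 'a alg_closure).
        (\<forall>j<n. (\<Sum>i<k. c i * poly (map_poly to_ac (G i j)) l) = 0) \<longrightarrow> (\<forall>i<k. c i = 0))"

definition row_deg :: "nat \<Rightarrow> (nat \<Rightarrow> nat \<Rightarrow> 'a::zero poly) \<Rightarrow> nat \<Rightarrow> nat" where
  "row_deg n G i = Max ((\<lambda>j. degree (G i j)) ` {..<n})"

definition minor :: "nat \<Rightarrow> (nat \<Rightarrow> nat \<Rightarrow> 'a::comm_ring_1 poly) \<Rightarrow> nat set \<Rightarrow> 'a poly" where
  "minor k G S = (\<Sum>p | p permutes {..<k}.
      of_int (sign p) * (\<Prod>i<k. G i (sorted_list_of_set S ! p i)))"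

definition max_minor_deg :: "nat \<Rightarrow> nat \<Rightarrow> (nat \<Rightarrow> nat \<Rightarrow> 'a::comm_ring_1 poly) \<Rightarrow> nat" where
  "max_minor_deg n k G = Max {degree (minor k G S) | S. S \<subseteq> {..<n} \<and> card S = k}"

definition minimal_enc :: "nat \<Rightarrow> nat \<Rightarrow> (nat \<Rightarrow> nat \<Rightarrow> 'a::comm_ring_1 poly) \<Rightarrow> bool" where
  "minimal_enc n k G \<longleftrightarrow> (\<Sum>i<k. row_deg n G i) = max_minor_deg n k G"

definition conv_code :: "nat \<Rightarrow> nat \<Rightarrow> (nat \<Rightarrow> 'a::field poly) set \<Rightarrow> bool" where
  "conv_code n k C \<longleftrightarrow> (\<exists>G. basic_enc n k G \<and> C = code_of n k G)"

text \<open>C has Forney indices nu_0, ..., nu_(k-1): it has a basic minimal encoder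
  whose row degrees are these numbers (Forney indices are unique up to order).\<close>
definition has_forney_indices :: "nat \<Rightarrow> nat \<Rightarrow> (nat \<Rightarrow> 'a::field poly) set \<Rightarrow> (nat \<Rightarrow> nat) \<Rightarrow> bool" where
  "has_forney_indices n k C \<nu> \<longleftrightarrow>
     (\<exists>G. basic_enc n k G \<and> minimal_enc n k G \<and> C = code_of n k G \<and> (\<forall>i<k. row_deg n G i = \<nu> i))"

definition A_carrier :: "nat \<Rightarrow> (nat \<Rightarrow> 'a::zero) set" where
  "A_carrier n = {a. \<forall>i\<ge>n. a i = 0}"

definition A_mult :: "(nat \<Rightarrow> 'a::times) \<Rightarrow> (nat \<Rightarrow> 'a) \<Rightarrow> nat \<Rightarrow> 'a" where
  "A_mult a b = (\<lambda>i. a i * b i)"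

definition A_one :: "nat \<Rightarrow> nat \<Rightarrow> 'a::{zero,one}" where
  "A_one n = (\<lambda>i. if i < n then 1 else 0)"

definition sigma :: "nat \<Rightarrow> (nat \<Rightarrow> 'a::zero) \<Rightarrow> nat \<Rightarrow> 'a" where
  "sigma n a = (\<lambda>i. if i < n then a ((i + n - 1) mod n) else 0)"

text \<open>A skew polynomial sum_nu z^nu a_nu is represented by its coefficient
  function nu |-> a_nu (finitely supported, values in A).\<close>
definition skew_carrier :: "nat \<Rightarrow> (nat \<Rightarrow> nat \<Rightarrow> 'a::zero) set" where
  "skew_carrier n = {f. (\<forall>\<nu>. f \<nu> \<in> A_carrier n) \<and> finite {\<nu>. f \<nu> \<noteq> (\<lambda>_. 0)}}"

text \<open>Multiplication determined by a z = z sigma(a), right coefficients: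
  (z^i a)(z^j b) = z^(i+j) sigma^j(a) b.\<close>
definition skew_mult :: "nat \<Rightarrow> (nat \<Rightarrow> nat \<Rightarrow> 'a::comm_semiring_0) \<Rightarrow> (nat \<Rightarrow> nat \<Rightarrow> 'a) \<Rightarrow> nat \<Rightarrow> nat \<Rightarrow> 'a" where
  "skew_mult n f g = (\<lambda>m. \<lambda>i. \<Sum>j\<le>m. A_mult (((sigma n) ^^ j) (f (m - j))) (g j) i)"

definition skew_left_ideal :: "nat \<Rightarrow> (nat \<Rightarrow> nat \<Rightarrow> 'a::comm_ring) set \<Rightarrow> bool" where
  "skew_left_ideal n I \<longleftrightarrow>
     I \<subseteq> skew_carrier n \<and> (\<lambda>_ _. 0) \<in> I \<and>
     (\<forall>f\<in>I. \<forall>g\<in>I. (\<lambda>\<nu> i. f \<nu> i + g \<nu> i) \<in> I) \<and>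
     (\<forall>f\<in>I. (\<lambda>\<nu> i. - f \<nu> i) \<in> I) \<and>
     (\<forall>r\<in>skew_carrier n. \<forall>f\<in>I. skew_mult n r f \<in> I)"

text \<open>F[x]/<x^n-1> is represented by the canonical residues (polynomials of
  degree < n), with product taken modulo x^n - 1.\<close>
definition cyc_mod :: "nat \<Rightarrow> 'a::field poly \<Rightarrow> 'a poly" where
  "cyc_mod n p = p mod (monom 1 n - 1)"

definition residues_cyc :: "nat \<Rightarrow> 'a::field poly set" where
  "residues_cyc n = {p. p = 0 \<or> degree p < n}"

definition alg_iso :: "nat \<Rightarrow> ('a::field poly \<Rightarrow> nat \<Rightarrow> 'a) \<Rightarrow> bool" where
  "alg_iso n \<phi> \<longleftrightarrow>
     bij_betw \<phi> (residues_cyc n) (A_carrier n) \<and>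
     (\<forall>p\<in>residues_cyc n. \<forall>q\<in>residues_cyc n. \<phi> (p + q) = (\<lambda>i. \<phi> p i + \<phi> q i)) \<and>
     (\<forall>c. \<forall>p\<in>residues_cyc n. \<phi> (smult c p) = (\<lambda>i. c * \<phi> p i)) \<and>
     (\<forall>p\<in>residues_cyc n. \<forall>q\<in>residues_cyc n. \<phi> (cyc_mod n (p * q)) = A_mult (\<phi> p) (\<phi> q)) \<and>
     \<phi> 1 = A_one n"

definition pmap :: "nat \<Rightarrow> ('a::field poly \<Rightarrow> nat \<Rightarrow> 'a) \<Rightarrow> (nat \<Rightarrow> 'a poly) \<Rightarrow> nat \<Rightarrow> nat \<Rightarrow> 'a" where
  "pmap n \<phi> v = (\<lambda>\<nu>. \<phi> (\<Sum>i<n. monom (coeff (v i) \<nu>) i))"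

definition sigma_cyclic_code :: "nat \<Rightarrow> nat \<Rightarrow> ('a::field poly \<Rightarrow> nat \<Rightarrow> 'a) \<Rightarrow> (nat \<Rightarrow> 'a poly) set \<Rightarrow> bool" where
  "sigma_cyclic_code n k \<phi> C \<longleftrightarrow> conv_code n k C \<and> skew_left_ideal n (pmap n \<phi> ` C)"

end

theory Submission
  imports Defs "HOL-Combinatorics.Orbits" "Jordan_Normal_Form.Determinant"
begin

text \<open>
  In the coordinates of A, a \<sigma>-cyclic code is a submodule of F[z]^n that is homogeneous for the
  Z/n-grading in which z^m e_y has degree y - m. So one looks for a basic matrix with homogeneous
  rows whose leading terms lie in distinct columns. Row x has the entries 1 in column x and
  z^(N x) in column \<pi> x = x + N x mod n; since there are at most two residues mod n, the positions
  can be chosen so that \<pi> extends to a permutation with one free position \<delta>. On the \<pi>-orbit of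
  \<delta> these rows are unimodular, but every other orbit contributes a determinant of the form
  1 \<plusminus> z^Q. To repair this, the orbits are ordered in a chain: as an orbit winds around the circle
  Z/n, one of its steps jumps over any given point y outside it, so that some row x of the orbit
  admits an additional entry z^((y - x) mod n) of degree less than N x in column y. Choosing y in
  the preceding orbit forces the kernel to vanish orbit by orbit, starting from \<delta>. Finally one
  multiplies by the constant matrix of the inverse of \<phi>, which preserves basicness, row degrees
  and the maximal degree of the minors.
\<close>

subsection \<open>Positions, orbits and linking chains\<close>

text \<open>Grow the set along a walk with step \<open>h\<close>: each stage absorbs the free point
  \<open>\<delta>\<close> and chooses a new one, so that \<open>\<delta>\<close> stays the only
  possible exit from \<open>B\<close>.\<close>

lemma exists_almost_shift_closed_set:
  fixes n b h :: nat
  assumes "b < n"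
  shows "\<exists>B \<delta>. B \<subseteq> {..<n} \<and> card B = b \<and> \<delta> < n \<and> \<delta> \<notin> B \<and>
    (\<forall>x\<in>B. (x + h) mod n \<in> insert \<delta> B)"
  using assms
proof (induction b)
  case 0
  then show ?case by (intro exI[of _ "{}"] exI[of _ 0]) auto
next
  case (Suc b)
  then obtain B \<delta> where B: "B \<subseteq> {..<n}" "card B = b" "\<delta> < n" "\<delta> \<notin> B"
    and shift: "\<And>x. x \<in> B \<Longrightarrow> (x + h) mod n \<in> insert \<delta> B"
    by auto
  have fin: "finite B" using B(1) finite_subset by blast
  have card: "card (insert \<delta> B) = Suc b" using B fin by simp
  have "insert \<delta> B \<noteq> {..<n}" using card Suc.prems by (metis card_lessThan nat_less_le)
  then obtain z where z: "z < n" "z \<notin> insert \<delta> B" using B by blast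
  \<comment> \<open>The walk goes on to \<open>\<delta> + h\<close>. If that point is already taken,
    nothing leaves the enlarged set and any fresh point \<open>z\<close> serves.\<close>
  define \<delta>' where "\<delta>' = (if (\<delta> + h) mod n \<in> insert \<delta> B then z else (\<delta> + h) mod n)"
  have "\<delta>' < n" "\<delta>' \<notin> insert \<delta> B" using z by (auto simp: \<delta>'_def)
  moreover have "(x + h) mod n \<in> insert \<delta>' (insert \<delta> B)" if "x \<in> insert \<delta> B" for x
    using that shift by (auto simp: \<delta>'_def)
  ultimately show ?case
    using card B by (intro exI[of _ "insert \<delta> B"] exI[of _ \<delta>']) auto
qed

text \<open>By counting, the image misses some point \<open>l\<close> of \<open>S\<close>, and
  \<open>\<delta>\<close> can be sent there.\<close>

lemma inj_on_diff_point_extends_permutation: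
  fixes f :: "'a \<Rightarrow> 'a"
  assumes "finite S" "\<delta> \<in> S" "inj_on f (S - {\<delta>})" "f ` (S - {\<delta>}) \<subseteq> S"
  shows "\<exists>\<pi>. \<pi> permutes S \<and> (\<forall>x\<in>S - {\<delta>}. \<pi> x = f x)"
proof -
  have "card (f ` (S - {\<delta>})) < card S"
    using assms by (metis card_Diff1_less card_image)
  then have "f ` (S - {\<delta>}) \<noteq> S" by auto
  then obtain l where l: "l \<in> S" "l \<notin> f ` (S - {\<delta>})" using assms(4) by blast
  define \<pi> where "\<pi> x = (if x \<in> S then if x = \<delta> then l else f x else x)" for x
  have "inj_on \<pi> S"
    using assms(3) l by (auto simp: inj_on_def \<pi>_def)
  moreover have "\<pi> ` S \<subseteq> S" using assms l by (auto simp: \<pi>_def)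
  ultimately have "bij_betw \<pi> S S"
    using assms(1) by (simp add: bij_betw_def endo_inj_surj)
  then have "\<pi> permutes S" by (rule bij_imp_permutes) (simp add: \<pi>_def)
  then show ?thesis by (intro exI[of _ \<pi>]) (auto simp: \<pi>_def)
qed

lemma add_mod_left_cancel_nat:
  fixes x y r n :: nat
  assumes "(x + r) mod n = (y + r) mod n" "x < n" "y < n"
  shows "x = y"
proof -
  have "(int x + int r) mod int n = (int y + int r) mod int n"
    using assms(1) by (metis of_nat_add of_nat_mod)
  then have "int x mod int n = int y mod int n"
    by (metis add_diff_cancel_right' mod_diff_left_eq)
  then show ?thesis using assms(2,3) by simp
qed

text \<open>Row i is put at position d i, where its constant term sits, and \<pi> (d i) is the position of its
  leading term. The point \<delta> is left free; N prescribes degrees also at positions without a row.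
  After subtracting the first residue, \<pi> fixes the rows of that residue and shifts all others by the
  difference of the two residues.\<close>
lemma exists_placement:
  fixes n k :: nat and \<nu> :: "nat \<Rightarrow> nat"
  assumes "1 \<le> k" "k \<le> n - 1" "card ((\<lambda>i. \<nu> i mod n) ` {..<k}) \<le> 2"
  shows "\<exists>\<delta> \<pi> N d. \<delta> < n \<and> \<pi> permutes {..<n} \<and>
    (\<forall>x<n. x \<noteq> \<delta> \<longrightarrow> \<pi> x = (x + N x) mod n) \<and>
    inj_on d {..<k} \<and> d ` {..<k} \<subseteq> {..<n} - {\<delta>} \<and> (\<forall>i<k. N (d i) = \<nu> i)"
proof -
  define r where "r = \<nu> 0 mod n"
  have n0: "n > 0" using assms by simp
  have r: "r < n" using n0 by (simp add: r_def)
  have "\<exists>s<n. \<forall>i<k. \<nu> i mod n = r \<or> \<nu> i mod n = s"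
  proof (cases "\<forall>i<k. \<nu> i mod n = r")
    case True
    then show ?thesis using r by blast
  next
    case False
    then obtain j where j: "j < k" "\<nu> j mod n \<noteq> r" by blast
    have "\<nu> i mod n = \<nu> j mod n" if "i < k" "\<nu> i mod n \<noteq> r" for i
    proof (rule ccontr)
      assume ne: "\<nu> i mod n \<noteq> \<nu> j mod n"
      have "r = (\<lambda>i. \<nu> i mod n) 0" by (simp add: r_def)
      then have "{r, \<nu> i mod n, \<nu> j mod n} \<subseteq> (\<lambda>i. \<nu> i mod n) ` {..<k}"
        using that j assms(1) by (auto intro!: image_eqI[of r _ 0])
      then have "card {r, \<nu> i mod n, \<nu> j mod n} \<le> 2"
        using assms(3) by (meson card_mono finite_imageI finite_lessThan le_trans)
      then show False using ne that j by auto
    qed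
    moreover have "\<nu> j mod n < n" using n0 by simp
    ultimately show ?thesis by blast
  qed
  then obtain s where s: "s < n" "\<And>i. i < k \<Longrightarrow> \<nu> i mod n = r \<or> \<nu> i mod n = s" by blast
  define I where "I = {i. i < k \<and> \<nu> i mod n \<noteq> r}"
  have I: "I \<subseteq> {..<k}" "finite I" by (auto simp: I_def)
  then have cI: "card I \<le> k" by (metis card_lessThan card_mono finite_lessThan)
  \<comment> \<open>\<open>h\<close> stands for \<open>s - r\<close> modulo \<open>n\<close>, kept
    nonnegative.\<close>
  define h where "h = s + (n - r)"
  obtain B \<delta> where B: "B \<subseteq> {..<n}" "card B = card I" "\<delta> < n" "\<delta> \<notin> B"
    and shift: "\<And>x. x \<in> B \<Longrightarrow> (x + h) mod n \<in> insert \<delta> B"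
  proof -
    have "card I < n" using cI assms(1,2) by linarith
    then show ?thesis using exists_almost_shift_closed_set[of "card I" n h] that by blast
  qed
  have finB: "finite B" using B(1) finite_subset by blast
  obtain d1 where d1: "bij_betw d1 I B" using I finB B(2) by (metis finite_same_card_bij)
  \<comment> \<open>Rows of residue \<open>r\<close> go to \<open>A\<close>, the others to
    \<open>B\<close>. Since \<open>k \<le> n - 1\<close>, there is room even without
    \<open>\<delta>\<close>.\<close>
  define A where "A = {..<n} - {\<delta>} - B"
  have cA: "card A = n - 1 - card I"
  proof -
    have "A = {..<n} - insert \<delta> B" by (auto simp: A_def)
    then show ?thesis using B finB by (simp add: card_Diff_subset)
  qed
  have "card ({..<k} - I) = k - card I" using I by (simp add: card_Diff_subset)
  then have "card ({..<k} - I) \<le> card A" using cA assms by simp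
  then obtain d2 where d2: "d2 ` ({..<k} - I) \<subseteq> A" "inj_on d2 ({..<k} - I)"
    by (metis A_def card_le_inj finite_Diff finite_lessThan)
  define d where "d i = (if i \<in> I then d1 i else d2 i)" for i
  have dI: "d i \<in> B" if "i \<in> I" for i
    using that d1 by (auto simp: d_def bij_betw_def)
  have dA: "d i \<in> A" if "i < k" "i \<notin> I" for i
    using that d2 by (auto simp: d_def)
  have AB: "A \<inter> B = {}" by (auto simp: A_def)
  have inj: "inj_on d {..<k}"
  proof (rule inj_onI)
    fix i j assume ij: "i \<in> {..<k}" "j \<in> {..<k}" "d i = d j"
    show "i = j"
      using ij dI[of i] dI[of j] dA[of i] dA[of j] AB d1 d2
      by (cases "i \<in> I"; cases "j \<in> I") (auto simp: d_def bij_betw_def inj_on_def)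
  qed
  have dsub: "d ` {..<k} \<subseteq> {..<n} - {\<delta>}"
    using dI dA B AB by (auto simp: A_def)
  \<comment> \<open>Positions without a row receive the residue of their class, so that
    \<open>N x mod n\<close> depends only on whether \<open>x\<close> lies in
    \<open>B\<close>.\<close>
  define N where "N x = (if x \<in> d ` {..<k} then \<nu> (inv_into {..<k} d x)
    else if x \<in> B then s else r)" for x
  have Nd: "N (d i) = \<nu> i" if "i < k" for i
    using that inj by (simp add: N_def)
  have Nmod: "N x mod n = (if x \<in> B then s else r)" for x
  proof (cases "x \<in> d ` {..<k}")
    case True
    then obtain i where i: "i < k" "x = d i" by auto
    have "i \<in> I \<longleftrightarrow> x \<in> B" using i dI dA AB by blast
    then show ?thesis using i s(2)[of i] by (auto simp: Nd I_def)
  next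
    case False
    then show ?thesis using r s by (simp add: N_def)
  qed
  define f where "f x = (x + N x) mod n" for x
  have fA: "f x = (x + r) mod n" if "x \<notin> B" for x
    using Nmod[of x] that by (metis f_def mod_add_right_eq)
  have fB: "f x = ((x + h) mod n + r) mod n" if "x \<in> B" for x
  proof -
    have "((x + h) mod n + r) mod n = (x + h + r) mod n" by (simp add: mod_add_left_eq)
    also have "x + h + r = (x + s) + n" using r by (simp add: h_def)
    also have "(x + s + n) mod n = (x + s) mod n" by simp
    finally show ?thesis using Nmod[of x] that by (metis f_def mod_add_right_eq)
  qed
  \<comment> \<open>\<open>f\<close> is \<open>g\<close> followed by the rotation by
    \<open>r\<close>, so injectivity is checked on \<open>g\<close>. It shifts \<open>B\<close> into
    \<open>insert \<delta> B\<close> and fixes the points outside \<open>B\<close>; off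
    \<open>\<delta>\<close> these cannot collide.\<close>
  define g where "g x = (if x \<in> B then (x + h) mod n else x)" for x
  have fg: "f x = (g x + r) mod n" for x using fA fB by (simp add: g_def)
  have gn: "g x < n" if "x < n" for x using that n0 by (simp add: g_def)
  have "inj_on g ({..<n} - {\<delta>})"
  proof (rule inj_onI)
    fix x y assume xy: "x \<in> {..<n} - {\<delta>}" "y \<in> {..<n} - {\<delta>}" "g x = g y"
    have "g z \<in> insert \<delta> B" if "z \<in> B" for z using shift that by (simp add: g_def)
    then show "x = y"
      using xy add_mod_left_cancel_nat[of x h n y]
      by (cases "x \<in> B"; cases "y \<in> B") (force simp: g_def)+
  qed
  then have "inj_on f ({..<n} - {\<delta>})"
    using gn by (auto simp: inj_on_def fg dest!: add_mod_left_cancel_nat)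
  moreover have "f ` ({..<n} - {\<delta>}) \<subseteq> {..<n}" using n0 by (auto simp: f_def)
  ultimately obtain \<pi> where \<pi>: "\<pi> permutes {..<n}" "\<forall>x\<in>{..<n} - {\<delta>}. \<pi> x = f x"
    using inj_on_diff_point_extends_permutation[of "{..<n}" \<delta> f] B(3) by auto
  then have "\<forall>x<n. x \<noteq> \<delta> \<longrightarrow> \<pi> x = (x + N x) mod n" by (simp add: f_def)
  then show ?thesis using B(3) \<pi>(1) inj dsub Nd by blast
qed

text \<open>The number of forward steps from \<open>x\<close> to \<open>y\<close> on a circle of
  \<open>n\<close> points; adding \<open>n\<close> first avoids truncated subtraction for positions
  below \<open>n\<close>.\<close>

definition gap :: "nat \<Rightarrow> nat \<Rightarrow> nat \<Rightarrow> nat" where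
  "gap n x y = (y + n - x) mod n"

lemma gap_less: "0 < n \<Longrightarrow> gap n x y < n"
  by (simp add: gap_def)

lemma gap_if:
  assumes "x < n" "y < n"
  shows "gap n x y = (if x \<le> y then y - x else y + n - x)"
proof (cases "x \<le> y")
  case True
  then have "gap n x y = ((y - x) + n) mod n" by (simp add: gap_def)
  also have "\<dots> = y - x" using assms by simp
  finally show ?thesis using True by simp
qed (use assms in \<open>simp add: gap_def\<close>)

lemma gap_eq_0_iff: "x < n \<Longrightarrow> y < n \<Longrightarrow> gap n x y = 0 \<longleftrightarrow> x = y"
  by (auto simp: gap_if)

lemma add_gap: "x < n \<Longrightarrow> y < n \<Longrightarrow> (x + gap n x y) mod n = y"
  by (simp add: gap_if)

lemma gap_step:
  assumes "x < n" "y < n" "s \<le> gap n x y"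
  shows "gap n ((x + s) mod n) y = gap n x y - s"
proof -
  have "s < n" using assms gap_less[of n x y] by linarith
  then have "(x + s) mod n = (if x + s < n then x + s else x + s - n)"
    using assms(1) by (simp add: mod_if)
  moreover have "(x + s) mod n < n" using assms(1) by simp
  ultimately show ?thesis
    using assms gap_if[of x n y] gap_if[of "(x + s) mod n" n y] by (auto split: if_splits)
qed

text \<open>A cycle of step lengths N winds around the circle of n points, so every point off the
  cycle is jumped over by one of its steps.\<close>
lemma orbit_jumps_over:
  assumes \<pi>: "\<pi> permutes {..<n}" and z: "z < n" and y: "y < n" "y \<notin> orbit \<pi> z"
    and step: "\<And>x. x \<in> orbit \<pi> z \<Longrightarrow> \<pi> x = (x + N x) mod n"
    and Nz: "0 < N z"
  shows "\<exists>x\<in>orbit \<pi> z. gap n x y < N x"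
proof -
  have perm: "permutation \<pi>" using \<pi> by (metis finite_lessThan permutation_permutes)
  have self: "z \<in> orbit \<pi> z" by (rule permutation_self_in_orbit[OF perm])
  have sub: "orbit \<pi> z \<subseteq> {..<n}" using permutes_orbit_subset[OF \<pi>, of z] z by simp
  \<comment> \<open>\<open>x\<close> is an orbit point with the shortest way forward to
    \<open>y\<close>.\<close>
  obtain x where x: "x \<in> orbit \<pi> z"
    and min: "\<And>x'. x' \<in> orbit \<pi> z \<Longrightarrow> gap n x y \<le> gap n x' y"
    using ex_has_least_nat[of "\<lambda>x. x \<in> orbit \<pi> z" z "\<lambda>x. gap n x y"] self by blast
  have xn: "x < n" using x sub by auto
  have "gap n x y < N x"
  proof (rule ccontr)
    assume le: "\<not> gap n x y < N x"
    \<comment> \<open>A step that does not pass beyond \<open>y\<close> would shorten the way unless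
      its length is 0. But then the orbit is \<open>{x}\<close>, so \<open>z = x\<close>, against
      \<open>0 < N z\<close>.\<close>
    have "gap n (\<pi> x) y \<ge> gap n x y" using min x orbit.step by metis
    then have "gap n x y \<le> gap n x y - N x"
      using gap_step[of x n y "N x"] xn y(1) le step[OF x] by simp
    then have "N x = 0"
      using gap_eq_0_iff[OF xn y(1)] x y(2) le by (cases "N x = 0") auto
    then have "\<pi> x = x" using step[OF x] xn by simp
    then have "orbit \<pi> x = {x}" by (simp add: orbit_eq_singleton_iff)
    moreover have "z \<in> orbit \<pi> x" using orbit_swap[OF self x] .
    ultimately show False using \<open>N x = 0\<close> Nz by simp
  qed
  then show ?thesis using x by blast
qed

text \<open>A longest chain works: if the orbit of some \<open>z\<close> with \<open>0 < N z\<close>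
  were missed, one of its steps would jump over the last member, and the start of that step could be
  appended. The gap condition leaves room for a linking entry below the leading degree.\<close>

lemma exists_linking_chain:
  assumes \<pi>: "\<pi> permutes {..<n}" and \<delta>: "\<delta> < n"
    and step: "\<And>x. x < n \<Longrightarrow> x \<noteq> \<delta> \<Longrightarrow> \<pi> x = (x + N x) mod n"
  shows "\<exists>xs. xs \<noteq> [] \<and> xs ! 0 = \<delta> \<and> set xs \<subseteq> {..<n} \<and>
    (\<forall>i<length xs. \<forall>j<length xs. i \<noteq> j \<longrightarrow> xs ! i \<notin> orbit \<pi> (xs ! j)) \<and>
    (\<forall>j. Suc j < length xs \<longrightarrow> gap n (xs ! Suc j) (xs ! j) < N (xs ! Suc j)) \<and>
    (\<forall>z<n. z \<noteq> \<delta> \<longrightarrow> 0 < N z \<longrightarrow> (\<exists>x\<in>set xs. z \<in> orbit \<pi> x))"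
proof -
  have perm: "permutation \<pi>" using \<pi> by (metis finite_lessThan permutation_permutes)
  note self = permutation_self_in_orbit[OF perm]
  define chain where "chain xs \<longleftrightarrow> xs \<noteq> [] \<and> xs ! 0 = \<delta> \<and> set xs \<subseteq> {..<n} \<and>
    (\<forall>i<length xs. \<forall>j<length xs. i \<noteq> j \<longrightarrow> xs ! i \<notin> orbit \<pi> (xs ! j)) \<and>
    (\<forall>j. Suc j < length xs \<longrightarrow> gap n (xs ! Suc j) (xs ! j) < N (xs ! Suc j))" for xs
  have "chain [\<delta>]" using \<delta> by (simp add: chain_def)
  \<comment> \<open>Each point lies in its own orbit, so chain members are distinct; hence a longest
    chain exists.\<close>
  moreover have "length xs < Suc n" if "chain xs" for xs
  proof -
    have "distinct xs" using that self unfolding chain_def distinct_conv_nth by metis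
    then have "length xs = card (set xs)" by (simp add: distinct_card)
    also have "\<dots> \<le> card {..<n}" using that by (intro card_mono) (auto simp: chain_def)
    finally show ?thesis by simp
  qed
  ultimately obtain xs where xs: "chain xs" and max: "\<And>ys. chain ys \<Longrightarrow> length ys \<le> length xs"
    by (metis (no_types, lifting) ex_has_greatest_nat)
  have "\<exists>x\<in>set xs. z \<in> orbit \<pi> x" if z: "z < n" "z \<noteq> \<delta>" "0 < N z" for z
  proof (rule ccontr)
    assume no: "\<not> ?thesis"
    have off: "x \<notin> orbit \<pi> x'" "x' \<notin> orbit \<pi> x" if "x \<in> orbit \<pi> z" "x' \<in> set xs" for x x'
    proof -
      have "z \<in> orbit \<pi> x" using orbit_swap[OF self that(1)] .
      then show "x \<notin> orbit \<pi> x'" using no that orbit_trans[of z \<pi> x x'] by blast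
      then show "x' \<notin> orbit \<pi> x" using orbit_swap[OF self] by blast
    qed
    define l where "l = xs ! (length xs - 1)"
    have ne: "xs \<noteq> []" and \<delta>0: "xs ! 0 = \<delta>" using xs by (auto simp: chain_def)
    have l: "l \<in> set xs" using ne by (simp add: l_def)
    have "\<delta> \<in> set xs" using ne \<delta>0 by (metis length_greater_0_conv nth_mem)
    have oz: "orbit \<pi> z \<subseteq> {..<n}" using permutes_orbit_subset[OF \<pi>, of z] z by simp
    have "l \<notin> orbit \<pi> z" using off(2)[OF self l] .
    \<comment> \<open>\<open>step\<close> excludes \<open>\<delta>\<close>, which the orbit of
      \<open>z\<close> avoids because \<open>\<delta>\<close> belongs to the chain.\<close>
    moreover have "\<pi> x = (x + N x) mod n" if "x \<in> orbit \<pi> z" for x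
      using that off(1)[OF that \<open>\<delta> \<in> set xs\<close>] self oz by (intro step) auto
    moreover have "l < n" using l xs by (auto simp: chain_def)
    ultimately obtain x where x: "x \<in> orbit \<pi> z" "gap n x l < N x"
      using orbit_jumps_over[OF \<pi> z(1), of l N] z(3) by blast
    have "chain (xs @ [x])"
      unfolding chain_def
    proof (intro conjI allI impI)
      fix i j assume ij: "i < length (xs @ [x])" "j < length (xs @ [x])" "i \<noteq> j"
      then consider "i < length xs" "j < length xs" | "i < length xs" "j = length xs"
        | "i = length xs" "j < length xs" by fastforce
      then show "(xs @ [x]) ! i \<notin> orbit \<pi> ((xs @ [x]) ! j)"
        using xs ij off[OF x(1)] by cases (auto simp: chain_def nth_append)
    next
      fix j assume j: "Suc j < length (xs @ [x])"
      show "gap n ((xs @ [x]) ! Suc j) ((xs @ [x]) ! j) < N ((xs @ [x]) ! Suc j)"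
      proof (cases "Suc j = length xs")
        case True
        then have "j = length xs - 1" by simp
        then show ?thesis using x(2) True by (simp add: nth_append l_def)
      next
        case False
        then show ?thesis using xs j by (auto simp: chain_def nth_append)
      qed
    qed (use xs x oz in \<open>auto simp: chain_def nth_append\<close>)
    from max[OF this] show False by simp
  qed
  then show ?thesis using xs unfolding chain_def by blast
qed

text \<open>The variable c z is fed through a z into the equation at \<pi> z; besides, only chain members feed, each
  into the equation of its predecessor. Starting from c = 0 at the first chain member, its whole
  orbit vanishes, and the equation at that member then passes the vanishing on to the next one.\<close>
lemma chain_system_trivial_kernel:
  fixes c a :: "nat \<Rightarrow> 'b::field" and b :: "nat \<Rightarrow> 'b"
  assumes \<pi>: "\<pi> permutes {..<n}" and xs: "set xs \<subseteq> {..<n}" "xs \<noteq> []"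
    and disj: "\<And>i j. i < length xs \<Longrightarrow> j < length xs \<Longrightarrow> i \<noteq> j \<Longrightarrow> xs ! i \<notin> orbit \<pi> (xs ! j)"
    and eq_link: "\<And>z j. z < n \<Longrightarrow> Suc j < length xs \<Longrightarrow> \<pi> z = xs ! j \<Longrightarrow>
      c (\<pi> z) + a z * c z + b j * c (xs ! Suc j) = 0"
    and eq: "\<And>z. z < n \<Longrightarrow> (\<And>j. Suc j < length xs \<Longrightarrow> \<pi> z \<noteq> xs ! j) \<Longrightarrow> c (\<pi> z) + a z * c z = 0"
    and b: "\<And>j. Suc j < length xs \<Longrightarrow> b j \<noteq> 0"
    and start: "c (xs ! 0) = 0"
    and rest: "\<And>z. z < n \<Longrightarrow> (\<And>x. x \<in> set xs \<Longrightarrow> z \<notin> orbit \<pi> x) \<Longrightarrow> \<pi> z = z \<and> a z = 0"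
    and z: "z < n"
  shows "c z = 0"
proof -
  have perm: "permutation \<pi>" using \<pi> by (metis finite_lessThan permutation_permutes)
  note self = permutation_self_in_orbit[OF perm]
  have orb: "c w = 0" if j: "j < length xs" "c (xs ! j) = 0" and w: "w \<in> orbit \<pi> (xs ! j)" for j w
  proof -
    \<comment> \<open>The orbit of \<open>xs ! j\<close> contains no other chain member, so until it
      returns to \<open>xs ! j\<close> its equations carry no link term.\<close>
    have key: "c (\<pi> u) = 0" if u: "c u = 0" "u \<in> orbit \<pi> (xs ! j)" for u
    proof (cases "\<pi> u = xs ! j")
      case False
      have "\<pi> u \<in> orbit \<pi> (xs ! j)" using u(2) by (rule orbit.step)
      then have "\<pi> u \<noteq> xs ! i" if "Suc i < length xs" for i
        using disj[of i j] that j(1) False by (cases "i = j") auto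
      moreover have "u < n"
        using u(2) permutes_orbit_subset[OF \<pi>, of "xs ! j"] xs j(1) nth_mem by fastforce
      ultimately show ?thesis using eq[of u] u by auto
    qed (use j in simp)
    show ?thesis using w
    proof induction
      case base
      then show ?case using key[OF j(2) self] .
    next
      case (step u)
      then show ?case using key by blast
    qed
  qed
  have chain0: "c (xs ! j) = 0" if "j < length xs" for j
    using that
  proof (induction j)
    case (Suc j)
    \<comment> \<open>\<open>u\<close> precedes \<open>xs ! j\<close> in its orbit. With
      \<open>c u = 0\<close> and \<open>c (xs ! j) = 0\<close>, its equation reduces to
      \<open>b j * c (xs ! Suc j) = 0\<close>.\<close>
    obtain u where u: "\<pi> u = xs ! j" using permutes_surj[OF \<pi>] by (metis surjD)
    have jn: "xs ! j < n" using Suc.prems xs(1) nth_mem[of j xs] by (auto simp del: nth_mem)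
    have "u < n" using u jn permutes_in_image[OF \<pi>, of u] by simp
    moreover have "u \<in> orbit \<pi> (xs ! j)"
      using u self[of u] permutation_orbit_step[OF perm, of u] by simp
    then have "c u = 0" using orb[of j u] Suc.IH Suc.prems by auto
    ultimately show ?case using eq_link[of u j] Suc u b[of j] by simp
  qed (use start in simp)
  show ?thesis
  proof (cases "\<exists>x\<in>set xs. z \<in> orbit \<pi> x")
    case True
    then show ?thesis using orb chain0 by (metis in_set_conv_nth)
  next
    case False
    then have "\<pi> z = z" "a z = 0" using rest z by blast+
    moreover have "\<pi> z \<noteq> xs ! j" if "Suc j < length xs" for j
      using False that self nth_mem \<open>\<pi> z = z\<close> by (metis Suc_lessD)
    ultimately show ?thesis using eq[OF z] by simp
  qed
qed

subsection \<open>Degrees of maximal minors\<close>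

text \<open>Minors list their columns in increasing order, whereas multilinear expansion yields
  arbitrary injections \<open>f\<close>; \<open>\<tau>\<close> records the difference.\<close>

lemma enumerated_by_permutation:
  fixes f :: "nat \<Rightarrow> 'b::linorder"
  assumes "inj_on f {0..<k}"
  obtains \<tau> where "\<tau> permutes {0..<k}"
    and "\<And>i. i < k \<Longrightarrow> f i = sorted_list_of_set (f ` {0..<k}) ! \<tau> i"
proof -
  define S where "S = f ` {0..<k}"
  define L where "L = sorted_list_of_set S"
  have len: "length L = k" using assms by (simp add: L_def S_def card_image)
  have L: "bij_betw (nth L) {0..<k} S"
    by (rule bij_betw_nth) (use len in \<open>auto simp: L_def S_def\<close>)
  define \<tau> where "\<tau> i = (if i \<in> {0..<k} then inv_into {0..<k} (nth L) (f i) else i)" for i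
  have "bij_betw (inv_into {0..<k} (nth L) \<circ> f) {0..<k} {0..<k}"
    using assms L by (intro bij_betw_trans[of f _ S] bij_betw_inv_into) (auto simp: bij_betw_def S_def)
  then have "bij_betw \<tau> {0..<k} {0..<k}"
    by (rule iffD1[OF bij_betw_cong, rotated]) (simp add: \<tau>_def)
  then have "\<tau> permutes {0..<k}" by (rule bij_imp_permutes) (simp add: \<tau>_def)
  moreover have "f i = L ! \<tau> i" if "i < k" for i
  proof -
    have "f i \<in> nth L ` {0..<k}" using that L by (simp add: bij_betw_def S_def)
    then show ?thesis using that by (simp add: \<tau>_def f_inv_into_f)
  qed
  ultimately show thesis unfolding L_def S_def by (rule that)
qed

text \<open>Expanding det (U Y) = 1 multilinearly along the inner index produces a nonzero maximal minor of U.\<close>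
lemma right_invertible_imp_nonzero_minor:
  fixes U Y :: "nat \<Rightarrow> nat \<Rightarrow> 'a::idom"
  assumes XY: "\<And>i j. i < k \<Longrightarrow> j < k \<Longrightarrow> (\<Sum>x<n. U i x * Y x j) = (if i = j then 1 else 0)"
  shows "\<exists>S. S \<subseteq> {..<n} \<and> card S = k \<and>
    (\<Sum>p | p permutes {..<k}. of_int (sign p) * (\<Prod>i<k. U i (sorted_list_of_set S ! p i))) \<noteq> 0"
proof -
  define v where "v x = vec k (\<lambda>j. U j x)" for x
  \<comment> \<open>Summing \<open>a i x\<close> over \<open>x\<close> gives row \<open>i\<close> of
    the transpose of \<open>U Y\<close>, the identity.\<close>
  define a where "a i x = Y x i \<cdot>\<^sub>v v x" for i x
  have va: "v x \<in> carrier_vec k" "a i x \<in> carrier_vec k" for i x by (simp_all add: v_def a_def)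
  let ?F = "{f. (\<forall>i\<in>{0..<k}. f i \<in> {..<n}) \<and> (\<forall>i. i \<notin> {0..<k} \<longrightarrow> f i = i)}"
  have "mat\<^sub>r k k (\<lambda>i. finsum_vec TYPE('a) k (a i) {..<n}) = 1\<^sub>m k"
  proof (rule eq_matI)
    fix i j assume "i < dim_row (1\<^sub>m k :: 'a mat)" "j < dim_col (1\<^sub>m k :: 'a mat)"
    then have ij: "i < k" "j < k" by simp_all
    have "finsum_vec TYPE('a) k (a i) {..<n} $ j = (\<Sum>x<n. a i x $ j)"
      using ij va by (intro index_finsum_vec) auto
    also have "\<dots> = (\<Sum>x<n. U j x * Y x i)"
      using ij by (intro sum.cong) (auto simp: a_def v_def mult.commute)
    finally show "mat\<^sub>r k k (\<lambda>i. finsum_vec TYPE('a) k (a i) {..<n}) $$ (i, j) = 1\<^sub>m k $$ (i, j)"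
      using ij XY by simp
  qed simp_all
  then have "(\<Sum>f\<in>?F. det (mat\<^sub>r k k (\<lambda>i. a i (f i)))) = 1"
    using det_linear_rows_sum[of "{..<n}" a k] va by simp
  then obtain f where f: "f \<in> ?F" "det (mat\<^sub>r k k (\<lambda>i. a i (f i))) \<noteq> 0"
    by (metis (no_types, lifting) sum.neutral zero_neq_one)
  define B where "B = mat\<^sub>r k k (\<lambda>i. v (f i))"
  have B: "B \<in> carrier_mat k k" by (simp add: B_def)
  have "det (mat\<^sub>r k k (\<lambda>i. a i (f i))) = (\<Prod>i\<in>{0..<k}. Y (f i) i) * det B"
    unfolding a_def B_def by (rule det_rows_mul) (use va in auto)
  then have detB: "det B \<noteq> 0" using f(2) by auto
  have inj: "inj_on f {0..<k}"
  proof (rule inj_onI, rule ccontr)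
    fix i j assume ij: "i \<in> {0..<k}" "j \<in> {0..<k}" "f i = f j" "i \<noteq> j"
    then have "row B i = row B j" by (simp add: B_def v_def)
    then show False using det_identical_rows[OF B, of i j] ij detB by simp
  qed
  define S where "S = f ` {0..<k}"
  define L where "L = sorted_list_of_set S"
  obtain \<tau> where \<tau>: "\<tau> permutes {0..<k}" "\<And>i. i < k \<Longrightarrow> f i = L ! \<tau> i"
    using enumerated_by_permutation[OF inj] by (auto simp: L_def S_def)
  define D where "D = mat k k (\<lambda>(i, j). U i (L ! j))"
  have D: "D \<in> carrier_mat k k" by (simp add: D_def)
  have "B = mat k k (\<lambda>(i, j). D\<^sup>T $$ (\<tau> i, j))"
    by (rule eq_matI) (use \<tau> in \<open>auto simp: B_def D_def v_def permutes_in_image[of \<tau> "{0..<k}", simplified]\<close>)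
  then have "det B = signof \<tau> * det (D\<^sup>T)"
    using det_permute_rows[of "D\<^sup>T" k \<tau>] D \<tau> by simp
  then have "det D \<noteq> 0" using detB det_transpose[OF D] by auto
  also have "det D = (\<Sum>p | p permutes {0..<k}. of_int (sign p) * (\<Prod>i=0..<k. D $$ (i, p i)))"
    by (rule det_def'[OF D])
  also have "\<dots> = (\<Sum>p | p permutes {..<k}. of_int (sign p) * (\<Prod>i<k. U i (L ! p i)))"
    unfolding atLeast0LessThan
  proof (rule sum.cong[OF refl])
    fix p assume "p \<in> {p. p permutes {..<k}}"
    then have "i < k \<Longrightarrow> p i < k" for i using permutes_in_image[of p "{..<k}" i] by simp
    then have "(\<Prod>i<k. D $$ (i, p i)) = (\<Prod>i<k. U i (L ! p i))"
      by (intro prod.cong) (auto simp: D_def)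
    then show "of_int (sign p) * (\<Prod>i<k. D $$ (i, p i)) = of_int (sign p) * (\<Prod>i<k. U i (L ! p i))"
      by simp
  qed
  finally have "(\<Sum>p | p permutes {..<k}. of_int (sign p) * (\<Prod>i<k. U i (L ! p i))) \<noteq> 0" .
  moreover have "S \<subseteq> {..<n}" using f(1) by (auto simp: S_def)
  moreover have "card S = k" using inj by (simp add: S_def card_image)
  ultimately show ?thesis unfolding L_def by blast
qed

text \<open>Any index other than \<open>a\<close> puts one factor above its bound. The bounds need
  not be attained, so these are formal leading coefficients.\<close>

lemma coeff_mult_at_degree_bounds:
  assumes "degree p \<le> a" "degree q \<le> b"
  shows "coeff (p * q) (a + b) = coeff p a * coeff q b"
proof -
  have "coeff (p * q) (a + b) = (\<Sum>i\<le>a + b. coeff p i * coeff q (a + b - i))"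
    by (rule coeff_mult)
  also have "\<dots> = (\<Sum>i\<in>{a}. coeff p i * coeff q (a + b - i))"
  proof (intro sum.mono_neutral_right ballI)
    fix i assume "i \<in> {..a + b} - {a}"
    then consider "a < i" | "b < a + b - i" by force
    then show "coeff p i * coeff q (a + b - i) = 0"
    proof cases
      case 1
      then have "coeff p i = 0" using assms by (intro coeff_eq_0) simp
      then show ?thesis by simp
    next
      case 2
      then have "coeff q (a + b - i) = 0" using assms by (intro coeff_eq_0) simp
      then show ?thesis by simp
    qed
  qed auto
  finally show ?thesis by simp
qed

lemma degree_coeff_prod_bounds:
  fixes f :: "'b \<Rightarrow> 'a::comm_ring_1 poly"
  assumes "finite I" "\<And>i. i \<in> I \<Longrightarrow> degree (f i) \<le> e i"
  shows "degree (prod f I) \<le> sum e I \<and> coeff (prod f I) (sum e I) = (\<Prod>i\<in>I. coeff (f i) (e i))"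
  using assms
proof (induction I rule: finite_induct)
  case (insert i I)
  then have IH: "degree (prod f I) \<le> sum e I" and d: "degree (f i) \<le> e i" by auto
  have "degree (f i * prod f I) \<le> e i + sum e I"
    using degree_mult_le[of "f i" "prod f I"] IH d by linarith
  then show ?case using insert coeff_mult_at_degree_bounds[OF d IH] by simp
qed simp

lemma degree_signed_prod_le:
  fixes f :: "'b \<Rightarrow> 'a::comm_ring_1 poly"
  assumes "finite I" "\<And>i. i \<in> I \<Longrightarrow> degree (f i) \<le> e i"
  shows "degree (of_int (sign p) * prod f I) \<le> sum e I"
  using degree_coeff_prod_bounds[OF assms] by (simp add: sign_def)

text \<open>Each term of a minor takes one entry from every row, which bounds its degree by the sum
  of \<open>e\<close>. The coefficient at this bound is the minor of the formal leading
  coefficients, so one nonzero such minor attains it.\<close>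

lemma max_minor_degI:
  fixes G :: "nat \<Rightarrow> nat \<Rightarrow> 'a::comm_ring_1 poly"
  assumes deg: "\<And>i j. i < k \<Longrightarrow> j < n \<Longrightarrow> degree (G i j) \<le> e i"
    and S: "S \<subseteq> {..<n}" "card S = k"
    and lead: "(\<Sum>p | p permutes {..<k}.
      of_int (sign p) * (\<Prod>i<k. coeff (G i (sorted_list_of_set S ! p i)) (e i))) \<noteq> 0"
  shows "max_minor_deg n k G = (\<Sum>i<k. e i)"
proof -
  have sub: "degree (G i (sorted_list_of_set T ! p i)) \<le> e i"
    if T: "T \<subseteq> {..<n}" "card T = k" and p: "p permutes {..<k}" and i: "i \<in> {..<k}" for T p i
  proof -
    have fin: "finite T" using T(1) finite_subset by blast
    have "p i < k" using permutes_in_image[OF p, of i] i by simp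
    then have "sorted_list_of_set T ! p i \<in> set (sorted_list_of_set T)"
      using T fin by (intro nth_mem) simp
    then show ?thesis using deg i T fin by auto
  qed
  have le: "degree (minor k G T) \<le> (\<Sum>i<k. e i)" if "T \<subseteq> {..<n}" "card T = k" for T
    unfolding minor_def
  proof (rule degree_sum_le)
    fix p assume "p \<in> {p. p permutes {..<k}}"
    then have p: "p permutes {..<k}" by simp
    show "degree (of_int (sign p) * (\<Prod>i<k. G i (sorted_list_of_set T ! p i))) \<le> (\<Sum>i<k. e i)"
      by (rule degree_signed_prod_le) (simp, erule sub[OF that p])
  qed (simp add: finite_permutations)
  have "coeff (minor k G S) (\<Sum>i<k. e i) = (\<Sum>p | p permutes {..<k}.
      of_int (sign p) * (\<Prod>i<k. coeff (G i (sorted_list_of_set S ! p i)) (e i)))"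
    unfolding minor_def coeff_sum
  proof (intro sum.cong refl)
    fix p assume "p \<in> {p. p permutes {..<k}}"
    then have p: "p permutes {..<k}" by simp
    have "coeff (\<Prod>i<k. G i (sorted_list_of_set S ! p i)) (\<Sum>i<k. e i) =
        (\<Prod>i<k. coeff (G i (sorted_list_of_set S ! p i)) (e i))"
      by (rule degree_coeff_prod_bounds[THEN conjunct2]) (simp, erule sub[OF S p])
    then show "coeff (of_int (sign p) * (\<Prod>i<k. G i (sorted_list_of_set S ! p i))) (\<Sum>i<k. e i) =
        of_int (sign p) * (\<Prod>i<k. coeff (G i (sorted_list_of_set S ! p i)) (e i))"
      by (simp add: sign_def)
  qed
  then have "(\<Sum>i<k. e i) \<le> degree (minor k G S)" using lead by (intro le_degree) simp
  then have eq: "degree (minor k G S) = (\<Sum>i<k. e i)" using le[OF S] by simp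
  show ?thesis
    unfolding max_minor_deg_def
  proof (rule Max_eqI)
    have "{degree (minor k G T) |T. T \<subseteq> {..<n} \<and> card T = k} \<subseteq> {..\<Sum>i<k. e i}"
      using le by auto
    then show "finite {degree (minor k G T) |T. T \<subseteq> {..<n} \<and> card T = k}"
      by (rule finite_subset) simp
    show "(\<Sum>i<k. e i) \<in> {degree (minor k G T) |T. T \<subseteq> {..<n} \<and> card T = k}"
      using S by (intro CollectI exI[of _ S]) (simp add: eq)
  qed (use le in auto)
qed

lemma row_deg_eqI:
  assumes "\<And>j. j < n \<Longrightarrow> degree (G i j) \<le> e" "j < n" "coeff (G i j) e \<noteq> 0"
  shows "row_deg n G i = e"
  unfolding row_deg_def
proof (rule Max_eqI)
  have "e \<le> degree (G i j)" using assms(3) by (rule le_degree)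
  then have "e = degree (G i j)" using assms(1)[OF assms(2)] by simp
  then show "e \<in> (\<lambda>j. degree (G i j)) ` {..<n}" using assms(2) by blast
qed (use assms(1) in auto)

subsection \<open>A basic matrix with homogeneous rows\<close>

definition eval_ac :: "'a::field alg_closure \<Rightarrow> 'a poly \<Rightarrow> 'a alg_closure" where
  "eval_ac l p = poly (map_poly to_ac p) l"

lemma eval_ac_add: "eval_ac l (p + q) = eval_ac l p + eval_ac l q"
proof -
  have "map_poly to_ac (p + q) = map_poly to_ac p + map_poly to_ac q"
    by (rule poly_eqI) (simp add: coeff_map_poly)
  then show ?thesis by (simp add: eval_ac_def)
qed

lemma eval_ac_smult: "eval_ac l (smult a p) = to_ac a * eval_ac l p"
proof -
  have "map_poly to_ac (smult a p) = smult (to_ac a) (map_poly to_ac p)"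
    by (rule poly_eqI) (simp add: coeff_map_poly)
  then show ?thesis by (simp add: eval_ac_def)
qed

lemma eval_ac_monom: "eval_ac l (monom 1 m) = l ^ m"
  by (simp add: eval_ac_def map_poly_monom poly_monom)

lemma eval_ac_0: "eval_ac l 0 = 0"
  by (simp add: eval_ac_def)

lemma eval_ac_1: "eval_ac l 1 = 1"
  using eval_ac_monom[of l 0] by simp

lemma eval_ac_sum: "eval_ac l (sum f S) = (\<Sum>i\<in>S. eval_ac l (f i))"
  by (induction S rule: infinite_finite_induct) (simp_all add: eval_ac_0 eval_ac_add)

text \<open>The link points backwards: the row at a chain member \<open>x\<close> gets its
  additional entry in the column of the preceding member \<open>y\<close>.\<close>

definition linked :: "'b list \<Rightarrow> 'b \<Rightarrow> 'b \<Rightarrow> bool" where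
  "linked xs x y \<longleftrightarrow> (\<exists>j. Suc j < length xs \<and> xs ! Suc j = x \<and> xs ! j = y)"

text \<open>For N x = 0 the row is the unit vector at x; position x then coincides with \<pi> x.\<close>
definition chain_row :: "nat \<Rightarrow> (nat \<Rightarrow> nat) \<Rightarrow> (nat \<Rightarrow> nat) \<Rightarrow> nat list \<Rightarrow> nat \<Rightarrow> nat \<Rightarrow> 'a::field poly" where
  "chain_row n \<pi> N xs x y = (if y = x then 1 else 0)
     + (if 0 < N x \<and> y = \<pi> x then monom 1 (N x) else 0)
     + (if linked xs x y then monom 1 (gap n x y) else 0)"

context
  fixes n \<delta> :: nat and \<pi> N :: "nat \<Rightarrow> nat" and xs :: "nat list"
  assumes \<pi>: "\<pi> permutes {..<n}" and \<delta>: "\<delta> < n"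
    and step: "\<And>x. x < n \<Longrightarrow> x \<noteq> \<delta> \<Longrightarrow> \<pi> x = (x + N x) mod n"
    and xs: "xs \<noteq> []" "xs ! 0 = \<delta>" "set xs \<subseteq> {..<n}"
    and disj: "\<And>i j. i < length xs \<Longrightarrow> j < length xs \<Longrightarrow> i \<noteq> j \<Longrightarrow> xs ! i \<notin> orbit \<pi> (xs ! j)"
    and gaps: "\<And>j. Suc j < length xs \<Longrightarrow> gap n (xs ! Suc j) (xs ! j) < N (xs ! Suc j)"
    and cover: "\<And>z. z < n \<Longrightarrow> z \<noteq> \<delta> \<Longrightarrow> 0 < N z \<Longrightarrow> \<exists>x\<in>set xs. z \<in> orbit \<pi> x"
begin

lemma self_in_orbit: "x \<in> orbit \<pi> x"
  using \<pi> by (metis finite_lessThan permutation_permutes permutation_self_in_orbit)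

lemma chain_nth_eq_iff:
  "i < length xs \<Longrightarrow> j < length xs \<Longrightarrow> xs ! i = xs ! j \<longleftrightarrow> i = j"
  using disj[of i j] self_in_orbit by metis

lemma linked_unique: "Suc j < length xs \<Longrightarrow> linked xs x (xs ! j) \<longleftrightarrow> x = xs ! Suc j"
  unfolding linked_def using chain_nth_eq_iff by (metis Suc_lessD)

lemma linked_gap: "linked xs x y \<Longrightarrow> gap n x y < N x"
  using gaps by (auto simp: linked_def)

lemma linked_neq: "linked xs x y \<Longrightarrow> x \<noteq> y"
  unfolding linked_def using chain_nth_eq_iff by (metis Suc_lessD n_not_Suc_n)

lemma degree_chain_row:
  "degree (chain_row n \<pi> N xs x y :: 'a::field poly) \<le> N x"
  unfolding chain_row_def
  by (intro degree_add_le) (auto simp: degree_monom_eq dest: linked_gap)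

text \<open>The link entry has degree below \<open>N x\<close>. If \<open>N x = 0\<close>, then
  \<open>\<pi> x = x\<close> and the constant entry is the leading one.\<close>

lemma coeff_chain_row_top:
  assumes "x < n" "x \<noteq> \<delta>"
  shows "coeff (chain_row n \<pi> N xs x y :: 'a::field poly) (N x) = (if y = \<pi> x then 1 else 0)"
  using step[OF assms] assms(1) linked_gap[of x y] by (auto simp: chain_row_def)

lemma chain_row_graded:
  assumes "x < n" "x \<noteq> \<delta>" "y < n" "coeff (chain_row n \<pi> N xs x y :: 'a::field poly) m \<noteq> 0"
  shows "(x + m) mod n = y"
proof -
  have "m = 0 \<and> y = x \<or> m = N x \<and> y = \<pi> x \<or> m = gap n x y"
    using assms(4) by (auto simp: chain_row_def split: if_splits)
  then show ?thesis using assms(1-3) step[OF assms(1,2)] add_gap[of x n y] by auto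
qed

text \<open>The condition \<open>c \<delta> = 0\<close> expresses that there is no row at
  \<open>\<delta>\<close>. At \<open>l = 0\<close> the matrix is the identity; elsewhere the link
  entries are invertible and vanishing travels along the chain.\<close>

lemma chain_rows_independent:
  fixes c :: "nat \<Rightarrow> 'a::field alg_closure"
  assumes c\<delta>: "c \<delta> = 0"
    and ker: "\<And>y. y < n \<Longrightarrow> (\<Sum>x<n. c x * eval_ac l (chain_row n \<pi> N xs x y)) = 0"
    and z: "z < n"
  shows "c z = 0"
proof -
  \<comment> \<open>The value 0 at \<open>N x = 0\<close> matches \<open>chain_row\<close>, which
    then has no second entry; \<open>l ^ 0\<close> would contribute 1.\<close>
  define a where "a x = (if 0 < N x then l ^ N x else 0)" for x
  have eqn: "c y + (\<Sum>x<n. if y = \<pi> x then a x * c x else 0)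
      + (\<Sum>x<n. if linked xs x y then l ^ gap n x y * c x else 0) = 0" if y: "y < n" for y
  proof -
    have "(\<Sum>x<n. c x * eval_ac l (chain_row n \<pi> N xs x y)) =
      (\<Sum>x<n. (if y = x then c x else 0) + (if y = \<pi> x then a x * c x else 0)
        + (if linked xs x y then l ^ gap n x y * c x else 0))"
      by (intro sum.cong)
        (auto simp: chain_row_def a_def eval_ac_add eval_ac_monom eval_ac_0 eval_ac_1 algebra_simps)
    then show ?thesis using ker[OF y] y by (simp add: sum.distrib)
  qed
  have inj: "\<pi> z = \<pi> x \<longleftrightarrow> x = z" for x z using permutes_inj[OF \<pi>] by (auto dest: injD)
  have into: "\<pi> z < n" if "z < n" for z using permutes_in_image[OF \<pi>, of z] that by simp
  \<comment> \<open>Indexing the columns as \<open>\<pi> z\<close> collapses the sum of leading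
    entries to the term \<open>x = z\<close>.\<close>
  have eq: "c (\<pi> z) + a z * c z + (\<Sum>x<n. if linked xs x (\<pi> z) then l ^ gap n x (\<pi> z) * c x else 0) = 0"
    if z: "z < n" for z
    using eqn[OF into[OF z]] z by (simp add: inj)
  show ?thesis
  proof (cases "l = 0")
    case True
    have "(\<Sum>x<n. if z = \<pi> x then a x * c x else 0) = 0"
      using True by (intro sum.neutral) (auto simp: a_def)
    moreover have "l ^ gap n x z = 0" if "x < n" "linked xs x z" for x
      using True that z linked_neq[of x z] gap_eq_0_iff[of x n z] by simp
    then have "(\<Sum>x<n. if linked xs x z then l ^ gap n x z * c x else 0) = 0"
      by (intro sum.neutral) auto
    ultimately show ?thesis using eqn[OF z] by simp
  next
    case False
    define b where "b j = l ^ gap n (xs ! Suc j) (xs ! j)" for j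
    show ?thesis
    proof (rule chain_system_trivial_kernel[OF \<pi> xs(3,1) disj, of c a b])
      fix z j assume z: "z < n" and j: "Suc j < length xs" "\<pi> z = xs ! j"
      have "xs ! Suc j < n" using j(1) xs(3) nth_mem by blast
      then have "(\<Sum>x<n. if linked xs x (\<pi> z) then l ^ gap n x (\<pi> z) * c x else 0) = b j * c (xs ! Suc j)"
        using linked_unique[OF j(1)] by (simp add: j(2) b_def)
      then show "c (\<pi> z) + a z * c z + b j * c (xs ! Suc j) = 0" using eq[OF z] by simp
    next
      fix z assume z: "z < n" and no: "\<And>j. Suc j < length xs \<Longrightarrow> \<pi> z \<noteq> xs ! j"
      have "\<not> linked xs x (\<pi> z)" for x unfolding linked_def using no by metis
      then show "c (\<pi> z) + a z * c z = 0" using eq[OF z] by simp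
    next
      fix z assume z: "z < n" and no: "\<And>x. x \<in> set xs \<Longrightarrow> z \<notin> orbit \<pi> x"
      have "\<delta> \<in> set xs" using xs(1,2) by (metis length_greater_0_conv nth_mem)
      then have "z \<noteq> \<delta>" using no self_in_orbit by blast
      then have "N z = 0" using cover[OF z] no by blast
      then show "\<pi> z = z \<and> a z = 0" using step[OF z \<open>z \<noteq> \<delta>\<close>] z by (simp add: a_def)
    qed (use False c\<delta> xs z in \<open>auto simp: b_def\<close>)
  qed
qed

end

text \<open>Row \<open>i\<close> sits at position \<open>d i\<close> and leads in column
  \<open>t i\<close>, the image of \<open>d i\<close> under \<open>\<pi>\<close>. The congruence
  expresses homogeneity.\<close>

lemma exists_graded_basic_matrix:
  fixes n k :: nat and \<nu> :: "nat \<Rightarrow> nat"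
  assumes "1 \<le> k" "k \<le> n - 1" "card ((\<lambda>i. \<nu> i mod n) ` {..<k}) \<le> 2"
  shows "\<exists>(H :: nat \<Rightarrow> nat \<Rightarrow> 'a::field poly) d t. basic_enc n k H \<and> inj_on t {..<k} \<and> t ` {..<k} \<subseteq> {..<n} \<and>
    (\<forall>i<k. \<forall>y<n. degree (H i y) \<le> \<nu> i \<and> coeff (H i y) (\<nu> i) = (if y = t i then 1 else 0) \<and>
      (\<forall>m. coeff (H i y) m \<noteq> 0 \<longrightarrow> (d i + m) mod n = y))"
proof -
  obtain \<delta> \<pi> N d where \<delta>: "\<delta> < n" and \<pi>: "\<pi> permutes {..<n}"
    and step: "\<And>x. x < n \<Longrightarrow> x \<noteq> \<delta> \<Longrightarrow> \<pi> x = (x + N x) mod n"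
    and d: "inj_on d {..<k}" "d ` {..<k} \<subseteq> {..<n} - {\<delta>}" and N: "\<And>i. i < k \<Longrightarrow> N (d i) = \<nu> i"
    using exists_placement[OF assms] by blast
  obtain xs where xs: "xs \<noteq> []" "xs ! 0 = \<delta>" "set xs \<subseteq> {..<n}"
    and disj: "\<And>i j. i < length xs \<Longrightarrow> j < length xs \<Longrightarrow> i \<noteq> j \<Longrightarrow> xs ! i \<notin> orbit \<pi> (xs ! j)"
    and gaps: "\<And>j. Suc j < length xs \<Longrightarrow> gap n (xs ! Suc j) (xs ! j) < N (xs ! Suc j)"
    and cover: "\<And>z. z < n \<Longrightarrow> z \<noteq> \<delta> \<Longrightarrow> 0 < N z \<Longrightarrow> \<exists>x\<in>set xs. z \<in> orbit \<pi> x"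
    using exists_linking_chain[OF \<pi> \<delta> step] by metis
  note facts = \<pi> \<delta> step xs disj gaps cover
  define H :: "nat \<Rightarrow> nat \<Rightarrow> 'a poly" where "H i = chain_row n \<pi> N xs (d i)" for i
  have di: "d i < n" "d i \<noteq> \<delta>" if "i < k" for i using d(2) that by auto
  have "basic_enc n k H"
    unfolding basic_enc_def
  proof (intro allI impI)
    fix l :: "'a alg_closure" and c i
    assume ker: "\<forall>j<n. (\<Sum>i<k. c i * poly (map_poly to_ac (H i j)) l) = 0" and i: "i < k"
    \<comment> \<open>Extending by 0 to positions without a row, \<open>\<delta>\<close> among them,
      gives a relation among all chain rows.\<close>
    define c' where "c' x = (if x \<in> d ` {..<k} then c (inv_into {..<k} d x) else 0)" for x
    have c'd: "c' (d i) = c i" if "i < k" for i using that d(1) by (simp add: c'_def)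
    have "c' (d i) = 0"
    proof (rule chain_rows_independent[OF facts, of c' l "d i"])
      show "c' \<delta> = 0" using d(2) by (auto simp: c'_def)
      fix y assume y: "y < n"
      have "(\<Sum>x<n. c' x * eval_ac l (chain_row n \<pi> N xs x y)) =
          (\<Sum>x\<in>d ` {..<k}. c' x * eval_ac l (chain_row n \<pi> N xs x y))"
        using d(2) by (intro sum.mono_neutral_right) (auto simp: c'_def)
      also have "\<dots> = (\<Sum>i<k. c i * eval_ac l (H i y))"
        using d(1) by (simp add: sum.reindex c'd H_def)
      finally show "(\<Sum>x<n. c' x * eval_ac l (chain_row n \<pi> N xs x y)) = 0"
        using ker y by (simp add: eval_ac_def)
    qed (use di i in auto)
    then show "c i = 0" using c'd[OF i] by simp
  qed
  moreover have "inj_on (\<pi> \<circ> d) {..<k}"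
    using d(1) permutes_inj[OF \<pi>] by (metis comp_inj_on inj_on_subset subset_UNIV)
  moreover have "(\<pi> \<circ> d) ` {..<k} \<subseteq> {..<n}"
    using di permutes_in_image[OF \<pi>] by auto
  moreover have "degree (H i y) \<le> \<nu> i \<and> coeff (H i y) (\<nu> i) = (if y = (\<pi> \<circ> d) i then 1 else 0) \<and>
      (\<forall>m. coeff (H i y) m \<noteq> 0 \<longrightarrow> (d i + m) mod n = y)" if i: "i < k" and y: "y < n" for i y
    using degree_chain_row[OF facts, of "d i" y] coeff_chain_row_top[OF facts di[OF i], of y]
      chain_row_graded[OF facts di[OF i] y] 
    unfolding H_def comp_apply N[OF i] by blast
  ultimately show ?thesis by blast
qed

subsection \<open>From graded matrices to skew left ideals\<close>

text \<open>\<open>\<Phi>\<close> is the matrix of \<open>\<phi>\<close> on row vectors, from the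
  monomial basis to the coordinates of A. Row \<open>j\<close> of \<open>M\<close> lists the
  coefficients of the preimage of the unit vector \<open>j\<close>.\<close>

lemma alg_iso_matrices:
  fixes \<phi> :: "'a::field poly \<Rightarrow> nat \<Rightarrow> 'a"
  assumes iso: "alg_iso n \<phi>" and n: "0 < n"
  shows "\<exists>\<Phi> M. (\<forall>c. \<phi> (\<Sum>i<n. monom (c i) i) = (\<lambda>j. \<Sum>i<n. c i * \<Phi> i j)) \<and>
    (\<forall>i<n. \<forall>j\<ge>n. \<Phi> i j = 0) \<and>
    (\<forall>j<n. \<forall>j'<n. (\<Sum>i<n. M j i * \<Phi> i j') = (if j = j' then 1 else 0))"
proof -
  have bij: "bij_betw \<phi> (residues_cyc n) (A_carrier n)"
    and add: "\<And>p q. p \<in> residues_cyc n \<Longrightarrow> q \<in> residues_cyc n \<Longrightarrow> \<phi> (p + q) = (\<lambda>i. \<phi> p i + \<phi> q i)"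
    and scale: "\<And>c p. p \<in> residues_cyc n \<Longrightarrow> \<phi> (smult c p) = (\<lambda>i. c * \<phi> p i)"
    using iso unfolding alg_iso_def by blast+
  have res: "p \<in> residues_cyc n \<longleftrightarrow> degree p < n" for p :: "'a poly"
    using n by (auto simp: residues_cyc_def)
  have resm: "monom a i \<in> residues_cyc n" if "i < n" for a :: 'a and i
    using that le_less_trans[OF degree_monom_le] by (simp add: res)
  define \<Phi> where "\<Phi> i = \<phi> (monom 1 i)" for i
  have mono: "\<phi> (monom a i) = (\<lambda>j. a * \<Phi> i j)" if "i < n" for a i
    using scale[OF resm[OF that], of a 1] by (simp add: smult_monom \<Phi>_def)
  have lin: "(\<Sum>i<m. monom (c i) i) \<in> residues_cyc n \<and>
      \<phi> (\<Sum>i<m. monom (c i) i) = (\<lambda>j. \<Sum>i<m. c i * \<Phi> i j)" if "m \<le> n" for m c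
    using that
  proof (induction m)
    case 0
    have "\<phi> 0 = (\<lambda>j. 0)" using mono[OF n, of 0] by simp
    then show ?case using n by (simp add: res)
  next
    case (Suc m)
    then have IH: "(\<Sum>i<m. monom (c i) i) \<in> residues_cyc n"
      "\<phi> (\<Sum>i<m. monom (c i) i) = (\<lambda>j. \<Sum>i<m. c i * \<Phi> i j)" and m: "m < n"
      by auto
    show ?case
      using IH resm[OF m] add[OF IH(1) resm[OF m]] mono[OF m]
      by (auto simp: res intro: degree_add_less)
  qed
  have supp: "\<Phi> i j = 0" if "i < n" "j \<ge> n" for i j
    using bij_betw_apply[OF bij resm[OF that(1), of 1]] that(2) by (simp add: A_carrier_def \<Phi>_def)
  have "\<exists>M. \<forall>j'<n. (\<Sum>i<n. M i * \<Phi> i j') = (if j = j' then 1 else 0)" if j: "j < n" for j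
  proof -
    define e :: "nat \<Rightarrow> 'a" where "e j' = (if j = j' then 1 else 0)" for j'
    have "e \<in> A_carrier n" using j by (simp add: A_carrier_def e_def)
    then have "e \<in> \<phi> ` residues_cyc n" using bij by (simp add: bij_betw_def)
    then obtain p where p: "p \<in> residues_cyc n" "\<phi> p = e" by blast
    have "p = (\<Sum>i\<le>n - 1. monom (coeff p i) i)"
      using p(1) n by (intro poly_as_sum_of_monoms'[symmetric]) (simp add: res)
    also have "{..n - 1} = {..<n}" using n by auto
    finally have "e = (\<lambda>j. \<Sum>i<n. coeff p i * \<Phi> i j)" using lin[of n "coeff p"] p(2) by simp
    then have "(\<Sum>i<n. coeff p i * \<Phi> i j') = (if j = j' then 1 else 0)" for j'
      by (simp add: fun_eq_iff e_def)
    then show ?thesis by blast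
  qed
  then obtain M where "\<forall>j<n. \<forall>j'<n. (\<Sum>i<n. M j i * \<Phi> i j') = (if j = j' then 1 else 0)"
    by metis
  then show ?thesis using lin supp by blast
qed

text \<open>Each application of \<sigma> moves the index back by one, written as adding
  \<open>n - 1\<close>.\<close>

lemma funpow_sigma:
  assumes "b \<in> A_carrier n" "i < n"
  shows "(sigma n ^^ j) b i = b ((i + j * (n - 1)) mod n)"
  using assms(2)
proof (induction j arbitrary: i)
  case (Suc j)
  have "(sigma n ^^ Suc j) b i = (sigma n ^^ j) b ((i + n - 1) mod n)"
    using Suc.prems by (simp add: sigma_def)
  also have "\<dots> = b (((i + n - 1) mod n + j * (n - 1)) mod n)" using Suc by simp
  also have "((i + n - 1) mod n + j * (n - 1)) mod n = (i + n - 1 + j * (n - 1)) mod n"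
    by (rule mod_add_left_eq)
  also have "i + n - 1 + j * (n - 1) = i + Suc j * (n - 1)" using Suc.prems by simp
  finally show ?case .
qed simp

text \<open>The skew polynomial of the codeword with message u, when the encoder is H times the coefficient
  matrix of the inverse of \<phi>.\<close>
definition encode :: "nat \<Rightarrow> nat \<Rightarrow> (nat \<Rightarrow> nat \<Rightarrow> 'a::field poly) \<Rightarrow> (nat \<Rightarrow> 'a poly) \<Rightarrow> nat \<Rightarrow> nat \<Rightarrow> 'a" where
  "encode n k H u = (\<lambda>m i. if i < n then coeff (\<Sum>a<k. u a * H a i) m else 0)"

text \<open>Both sides run over all \<open>F s e t\<close> with \<open>s + e + t = m\<close>,
  grouped by \<open>e + t\<close> on the left and by \<open>s + e\<close> on the right.\<close>

lemma convolution_shift: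
  fixes F :: "nat \<Rightarrow> nat \<Rightarrow> nat \<Rightarrow> 'a::comm_monoid_add"
  shows "(\<Sum>j\<le>m. \<Sum>e\<le>j. F (m - j) e (j - e)) = (\<Sum>p\<le>m. \<Sum>e\<le>p. F (p - e) e (m - p))"
proof -
  have "(\<Sum>(j, e)\<in>Sigma {..m} (\<lambda>j. {..j}). F (m - j) e (j - e)) =
      (\<Sum>(p, e)\<in>Sigma {..m} (\<lambda>p. {..p}). F (p - e) e (m - p))"
    by (rule sum.reindex_bij_witness[where i = "\<lambda>(p, e). (m - p + e, e)" and j = "\<lambda>(j, e). (m - j + e, e)"])
      auto
  then show ?thesis by (simp add: sum.Sigma)
qed

text \<open>By homogeneity, applying a power of \<sigma> to a coefficient of r only depends on the row and on the degree
  of the term of u, so the factor r can be moved onto the message.\<close>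
lemma skew_mult_encode:
  fixes H :: "nat \<Rightarrow> nat \<Rightarrow> 'a::field poly"
  assumes graded: "\<And>a i m. a < k \<Longrightarrow> i < n \<Longrightarrow> coeff (H a i) m \<noteq> 0 \<Longrightarrow> (d a + m) mod n = i"
    and r: "r \<in> skew_carrier n"
  shows "\<exists>u'. skew_mult n r (encode n k H u) = encode n k H u'"
proof -
  have rA: "r s \<in> A_carrier n" for s using r by (simp add: skew_carrier_def)
  have "finite {s. r s \<noteq> (\<lambda>_. 0)}" using r by (simp add: skew_carrier_def)
  then obtain K where K: "\<And>s. K < s \<Longrightarrow> r s = (\<lambda>_. 0)"
    by (metis (mono_tags, lifting) finite_nat_set_iff_bounded_le leD mem_Collect_eq)
  \<comment> \<open>\<open>g a\<close> lists the coefficients of the new message. Modulo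
    \<open>n\<close> the index of \<open>r\<close> is \<open>d a - e\<close>, which involves no
    degree in \<open>H a\<close>.\<close>
  define g where "g a m = (\<Sum>e\<le>m. r (m - e) ((d a + e * (n - 1)) mod n) * coeff (u a) e)" for a m
  have "\<exists>p. coeff p = g a" for a
  proof -
    have "g a m = 0" if "m > degree (u a) + K" for m
      unfolding g_def
    proof (intro sum.neutral ballI)
      fix e assume "e \<in> {..m}"
      show "r (m - e) ((d a + e * (n - 1)) mod n) * coeff (u a) e = 0"
      proof (cases "e \<le> degree (u a)")
        case True
        then show ?thesis using K[of "m - e"] that by simp
      qed (simp add: coeff_eq_0)
    qed
    then show ?thesis using coeff_Abs_poly[of "degree (u a) + K" "g a"] by blast
  qed
  then obtain u' where u': "\<And>a. coeff (u' a) = g a" by metis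
  have "skew_mult n r (encode n k H u) m i = encode n k H u' m i" for m i
  proof (cases "i < n")
    case False
    then show ?thesis by (simp add: skew_mult_def A_mult_def encode_def)
  next
    case i: True
    have one: "(\<Sum>j\<le>m. r (m - j) ((i + j * (n - 1)) mod n) * coeff (u a * H a i) j) =
        coeff (u' a * H a i) m" if a: "a < k" for a
    proof -
      define F where "F s e t = r s ((d a + e * (n - 1)) mod n) * coeff (u a) e * coeff (H a i) t" for s e t
      have "r (m - j) ((i + j * (n - 1)) mod n) * (coeff (u a) e * coeff (H a i) (j - e)) =
          F (m - j) e (j - e)" if ej: "e \<le> j" for e j
      proof (cases "coeff (H a i) (j - e) = 0")
        case False
        \<comment> \<open>Homogeneity turns \<open>i - j\<close> into \<open>d a - e\<close> modulo
          \<open>n\<close>, with \<open>n - 1\<close> in the role of -1.\<close>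
        then have "i = (d a + (j - e)) mod n" using graded[OF a i] by simp
        then have "(i + j * (n - 1)) mod n = (d a + (j - e) + j * (n - 1)) mod n"
          by (simp add: mod_add_left_eq)
        also have "d a + (j - e) + j * (n - 1) = d a + e * (n - 1) + (j - e) * n"
        proof -
          obtain t where t: "j = e + t" using ej le_Suc_ex by blast
          obtain n' where "n = Suc n'" using i not0_implies_Suc by fastforce
          then show ?thesis by (simp add: t algebra_simps)
        qed
        also have "\<dots> mod n = (d a + e * (n - 1)) mod n" by simp
        finally show ?thesis by (simp add: F_def)
      qed (simp add: F_def)
      then have "(\<Sum>j\<le>m. r (m - j) ((i + j * (n - 1)) mod n) * coeff (u a * H a i) j) =
          (\<Sum>j\<le>m. \<Sum>e\<le>j. F (m - j) e (j - e))"
        by (simp add: coeff_mult sum_distrib_left)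
      also have "\<dots> = (\<Sum>p\<le>m. \<Sum>e\<le>p. F (p - e) e (m - p))" by (rule convolution_shift)
      also have "\<dots> = coeff (u' a * H a i) m"
        by (simp add: coeff_mult u' g_def F_def sum_distrib_right)
      finally show ?thesis .
    qed
    have "skew_mult n r (encode n k H u) m i =
        (\<Sum>j\<le>m. r (m - j) ((i + j * (n - 1)) mod n) * (\<Sum>a<k. coeff (u a * H a i) j))"
      using i rA by (simp add: skew_mult_def A_mult_def encode_def funpow_sigma coeff_sum)
    also have "\<dots> = (\<Sum>a<k. \<Sum>j\<le>m. r (m - j) ((i + j * (n - 1)) mod n) * coeff (u a * H a i) j)"
      by (simp add: sum_distrib_left sum.swap[of _ "{..m}"])
    also have "\<dots> = encode n k H u' m i" using i one by (simp add: encode_def coeff_sum)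
    finally show ?thesis .
  qed
  then show ?thesis by blast
qed

lemma skew_left_ideal_range_encode:
  fixes H :: "nat \<Rightarrow> nat \<Rightarrow> 'a::field poly"
  assumes graded: "\<And>a i m. a < k \<Longrightarrow> i < n \<Longrightarrow> coeff (H a i) m \<noteq> 0 \<Longrightarrow> (d a + m) mod n = i"
  shows "skew_left_ideal n (range (encode n k H))"
  unfolding skew_left_ideal_def
proof (intro conjI ballI)
  have "encode n k H u \<in> skew_carrier n" for u
  proof -
    have "{m. encode n k H u m \<noteq> (\<lambda>_. 0)} \<subseteq> (\<Union>i<n. {..degree (\<Sum>a<k. u a * H a i)})"
      by (auto simp: encode_def fun_eq_iff simp del: coeff_sum intro: le_degree split: if_splits)
    then have "finite {m. encode n k H u m \<noteq> (\<lambda>_. 0)}" by (rule finite_subset) simp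
    then show ?thesis by (simp add: skew_carrier_def A_carrier_def encode_def)
  qed
  then show "range (encode n k H) \<subseteq> skew_carrier n" by blast
  have "(\<lambda>_ _. 0) = encode n k H (\<lambda>_. 0)" by (simp add: encode_def fun_eq_iff)
  then show "(\<lambda>_ _. 0) \<in> range (encode n k H)" by blast
next
  fix f g assume "f \<in> range (encode n k H)" "g \<in> range (encode n k H)"
  then obtain u u' where "f = encode n k H u" "g = encode n k H u'" by blast
  then have "(\<lambda>m i. f m i + g m i) = encode n k H (\<lambda>a. u a + u' a)"
    by (simp add: encode_def fun_eq_iff sum.distrib algebra_simps)
  then show "(\<lambda>m i. f m i + g m i) \<in> range (encode n k H)" by blast
next
  fix f assume "f \<in> range (encode n k H)"
  then obtain u where "f = encode n k H u" by blast
  then have "(\<lambda>m i. - f m i) = encode n k H (\<lambda>a. - u a)"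
    by (simp add: encode_def fun_eq_iff sum_negf)
  then show "(\<lambda>m i. - f m i) \<in> range (encode n k H)" by blast
next
  fix r f :: "nat \<Rightarrow> nat \<Rightarrow> 'a" assume "r \<in> skew_carrier n" "f \<in> range (encode n k H)"
  then obtain u where r: "r \<in> skew_carrier n" and f: "f = encode n k H u" by blast
  obtain u' where "skew_mult n r (encode n k H u) = encode n k H u'"
    using skew_mult_encode[where H = H and d = d and u = u, OF graded r] by blast
  then show "skew_mult n r f \<in> range (encode n k H)" by (simp add: f)
qed

text \<open>Associativity: \<open>h M \<Phi> = h\<close> since \<open>M \<Phi> = 1\<close>. It
  serves both over F and over its algebraic closure.\<close>

lemma sum_double_right_inverse:
  fixes M \<Phi> :: "nat \<Rightarrow> nat \<Rightarrow> 'b::comm_ring_1"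
  assumes "\<And>y. y < n \<Longrightarrow> (\<Sum>j<n. M y j * \<Phi> j y') = (if y = y' then 1 else 0)" "y' < n"
  shows "(\<Sum>j<n. (\<Sum>y<n. h y * M y j) * \<Phi> j y') = h y'"
proof -
  have "(\<Sum>j<n. (\<Sum>y<n. h y * M y j) * \<Phi> j y') = (\<Sum>j<n. \<Sum>y<n. h y * (M y j * \<Phi> j y'))"
    by (simp add: sum_distrib_right mult.assoc)
  also have "\<dots> = (\<Sum>y<n. h y * (\<Sum>j<n. M y j * \<Phi> j y'))"
    by (subst sum.swap) (simp add: sum_distrib_left)
  also have "\<dots> = (\<Sum>y<n. if y = y' then h y else 0)"
    using assms(1) by (intro sum.cong) simp_all
  also have "\<dots> = h y'" using assms(2) by simp
  finally show ?thesis .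
qed

section \<open>The encoder in the original coordinates\<close>

theorem theorem4p11:
  fixes \<phi> :: "'a::{finite,field} poly \<Rightarrow> nat \<Rightarrow> 'a"
    and n k :: nat and \<nu> :: "nat \<Rightarrow> nat"
  assumes "n \<ge> 2" and "n dvd card (UNIV :: 'a set) - 1"
    and "alg_iso n \<phi>"
    and "1 \<le> k" and "k \<le> n - 1"
    and "card ((\<lambda>i. \<nu> i mod n) ` {..<k}) \<le> 2"
  shows "\<exists>C. sigma_cyclic_code n k \<phi> C \<and> has_forney_indices n k C \<nu>"
proof -
  obtain H :: "nat \<Rightarrow> nat \<Rightarrow> 'a poly" and d t where basic: "basic_enc n k H"
    and t: "inj_on t {..<k}" "t ` {..<k} \<subseteq> {..<n}"
    and H: "\<forall>i<k. \<forall>y<n. degree (H i y) \<le> \<nu> i \<and> coeff (H i y) (\<nu> i) = (if y = t i then 1 else 0) \<and>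
      (\<forall>m. coeff (H i y) m \<noteq> 0 \<longrightarrow> (d i + m) mod n = y)"
    using exists_graded_basic_matrix[OF assms(4-6)] by (elim exE conjE) (rule that)
  have deg: "degree (H i y) \<le> \<nu> i"
    and lead: "coeff (H i y) (\<nu> i) = (if y = t i then 1 else 0)"
    and graded: "coeff (H i y) m \<noteq> 0 \<Longrightarrow> (d i + m) mod n = y" if "i < k" "y < n" for i y m
    using H that by blast+
  have n: "0 < n" using assms(1) by simp
  obtain \<Phi> M where \<Phi>: "\<forall>c. \<phi> (\<Sum>i<n. monom (c i) i) = (\<lambda>j. \<Sum>i<n. c i * \<Phi> i j)"
    and \<Phi>0: "\<forall>i<n. \<forall>j\<ge>n. \<Phi> i j = 0"
    and inv: "\<forall>j<n. \<forall>j'<n. (\<Sum>i<n. M j i * \<Phi> i j') = (if j = j' then 1 else 0)"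
    using alg_iso_matrices[OF assms(3) n] by (elim exE conjE) (rule that)
  \<comment> \<open>\<open>G\<close> is the product \<open>H M\<close>: the rows of \<open>H\<close>
    live in the coordinates of A, and \<open>M\<close> carries them back to coefficient
    vectors.\<close>
  define G where "G i j = (\<Sum>y<n. smult (M y j) (H i y))" for i j
  have tn: "t i < n" if "i < k" for i using t(2) that by auto
  have degG: "degree (G i j) \<le> \<nu> i" if "i < k" for i j
    unfolding G_def using that deg by (intro degree_sum_le) (auto intro: order_trans[OF degree_smult_le])
  have leadG: "coeff (G i j) (\<nu> i) = M (t i) j" if "i < k" for i j
  proof -
    have "coeff (G i j) (\<nu> i) = (\<Sum>y<n. if y = t i then M y j else 0)"
      unfolding G_def coeff_sum using that lead by (intro sum.cong) auto
    then show ?thesis using tn[OF that] by simp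
  qed
  have "basic_enc n k G"
    unfolding basic_enc_def
  proof (intro allI impI)
    fix l :: "'a alg_closure" and c i
    assume ker: "\<forall>j<n. (\<Sum>i<k. c i * poly (map_poly to_ac (G i j)) l) = 0" and i: "i < k"
    \<comment> \<open>\<open>h\<close> is the combination of the rows of \<open>H\<close> at
      \<open>l\<close>. The hypothesis says \<open>h M = 0\<close>, and multiplying by
      \<open>\<Phi>\<close> gives \<open>h = 0\<close>.\<close>
    define h where "h y = (\<Sum>i<k. c i * eval_ac l (H i y))" for y
    have "(\<Sum>y<n. h y * to_ac (M y j)) = 0" if "j < n" for j
    proof -
      have "(\<Sum>y<n. h y * to_ac (M y j)) = (\<Sum>i<k. c i * eval_ac l (G i j))"
        unfolding h_def G_def eval_ac_sum eval_ac_smult sum_distrib_right sum_distrib_left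
        by (subst sum.swap) (simp add: mult_ac)
      then show ?thesis using ker that by (simp add: eval_ac_def)
    qed
    moreover have "(\<Sum>j<n. (\<Sum>y<n. h y * to_ac (M y j)) * to_ac (\<Phi> j y')) = h y'" if "y' < n" for y'
    proof (rule sum_double_right_inverse)
      fix y assume "y < n"
      have "(\<Sum>j<n. to_ac (M y j) * to_ac (\<Phi> j y')) = to_ac (\<Sum>j<n. M y j * \<Phi> j y')"
        by (simp add: to_ac_sum)
      then show "(\<Sum>j<n. to_ac (M y j) * to_ac (\<Phi> j y')) = (if y = y' then 1 else 0)"
        using inv \<open>y < n\<close> that by simp
    qed (use that in simp)
    ultimately have "h y = 0" if "y < n" for y using that by fastforce
    then show "c i = 0"
      using basic i unfolding basic_enc_def h_def eval_ac_def by blast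
  qed
  moreover have rd: "row_deg n G i = \<nu> i" if i: "i < k" for i
  proof -
    have "\<exists>j<n. M (t i) j \<noteq> 0"
    proof (rule ccontr)
      assume "\<not> ?thesis"
      then have "(\<Sum>j<n. M (t i) j * \<Phi> j (t i)) = 0" by simp
      then show False using inv tn[OF i] by simp
    qed
    then show ?thesis using row_deg_eqI[of n G i "\<nu> i"] degG leadG i by metis
  qed
  moreover have "minimal_enc n k G"
  proof -
    \<comment> \<open>The leading coefficients of \<open>G\<close> form the rows \<open>t i\<close>
      of \<open>M\<close>. The columns \<open>t j\<close> of \<open>\<Phi>\<close> are a right
      inverse, as \<open>t\<close> is injective.\<close>
    have "(\<Sum>x<n. M (t i) x * \<Phi> x (t j)) = (if i = j then 1 else 0)" if "i < k" "j < k" for i j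
      using inv tn[OF that(1)] tn[OF that(2)] t(1) that by (simp add: inj_on_eq_iff)
    then obtain S where S: "S \<subseteq> {..<n}" "card S = k"
      "(\<Sum>p | p permutes {..<k}. of_int (sign p) * (\<Prod>i<k. M (t i) (sorted_list_of_set S ! p i))) \<noteq> 0"
      using right_invertible_imp_nonzero_minor[where k = k and n = n and U = "\<lambda>i. M (t i)"
          and Y = "\<lambda>x j. \<Phi> x (t j)"] by blast
    have "max_minor_deg n k G = (\<Sum>i<k. \<nu> i)"
    proof (rule max_minor_degI[OF _ S(1,2)])
      show "(\<Sum>p | p permutes {..<k}. of_int (sign p) *
          (\<Prod>i<k. coeff (G i (sorted_list_of_set S ! p i)) (\<nu> i))) \<noteq> 0"
        using S(3) leadG by simp
    qed (rule degG)
    then show ?thesis using rd by (simp add: minimal_enc_def)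
  qed
  ultimately have forney: "has_forney_indices n k (code_of n k G) \<nu>"
    and conv: "conv_code n k (code_of n k G)"
    unfolding has_forney_indices_def conv_code_def by blast+
  have "pmap n \<phi> (\<lambda>j. if j < n then (\<Sum>a<k. u a * G a j) else 0) = encode n k H u" for u
  proof (intro ext)
    fix m i
    \<comment> \<open>In each degree the codeword is the combination of the rows of \<open>H\<close>
      times \<open>M\<close>; applying \<open>\<phi>\<close> multiplies by \<open>\<Phi>\<close> and
      undoes \<open>M\<close>.\<close>
    have "coeff (\<Sum>a<k. u a * G a j) m = (\<Sum>y<n. coeff (\<Sum>a<k. u a * H a y) m * M y j)" for j
      unfolding G_def sum_distrib_left coeff_sum sum_distrib_right
      by (subst sum.swap) (simp add: mult.commute)
    then have "pmap n \<phi> (\<lambda>j. if j < n then (\<Sum>a<k. u a * G a j) else 0) m i =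
        (\<Sum>j<n. (\<Sum>y<n. coeff (\<Sum>a<k. u a * H a y) m * M y j) * \<Phi> j i)"
      by (simp add: pmap_def \<Phi>)
    also have "\<dots> = encode n k H u m i"
      using sum_double_right_inverse[of n M \<Phi> i "\<lambda>y. coeff (\<Sum>a<k. u a * H a y) m"] inv \<Phi>0
      by (cases "i < n") (simp_all add: encode_def)
    finally show "pmap n \<phi> (\<lambda>j. if j < n then (\<Sum>a<k. u a * G a j) else 0) m i = encode n k H u m i" .
  qed
  then have "pmap n \<phi> ` code_of n k G = range (encode n k H)"
    unfolding code_of_def by (auto simp: image_iff) metis+
  then have "sigma_cyclic_code n k \<phi> (code_of n k G)"
    using conv skew_left_ideal_range_encode[of k n H d] graded by (simp add: sigma_cyclic_code_def)
  then show ?thesis using forney by blast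
qed

end
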